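(* Let $k\ge 1$, $n = 2^k-1$, and let $s_1,\dots,s_d$ be independent uniformly random elements of $\mathit{GL}_k(\mathbb{F}_2)$. Let $\omega = w_{2m}\cdots w_1$ be a word of length $2m$ whose literals are chosen independently and uniformly from $\{s_1,s_1^{-1},\dots,s_d,s_d^{-1}\}$ (independently of the values of the $s_j$), and let $v_1\in\mathbb{F}_2^k\setminus\{0\}$ be fixed. Then $$\mathbf{P}(\omega v_1 = v_1 \mid \text{at least one letter appears in } \omega \text{ exactly three times}) \le \frac{5}{n}.$$ In particular, if $X_3$ is the event that no letter appears in $\omega$ exactly once or exactly twice and at least one letter appears exactly three times, then $\mathbf{P}(\omega v_1 = v_1 \mid X_3) \le \frac{5}{n}$.
   Context: A letter $s_j$ "appears" in $\omega$ at each position where the literal $s_j$ or $s_j^{-1}$ occurs; $\omega v_1$ denotes $w_{2m}\cdots w_1 v_1$. The probability is over both the word $\omega$ and the values of $s_1,\dots,s_d$. *)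

theory Defs
  imports "HOL-Analysis.Analysis" "HOL-Probability.Probability" "HOL-Library.Z2"
begin

text \<open>A literal is a pair (j, b): index j < d of the generator s_(j+1); b = True means s_j,
  b = False means the inverse of s_j.\<close>
type_synonym literal = "nat \<times> bool"

definition lit_mat :: "('a::field ^'k^'k) list \<Rightarrow> literal \<Rightarrow> 'a ^'k^'k" where
  "lit_mat s l = (if snd l then s ! fst l else matrix_inv (s ! fst l))"

text \<open>The word is stored as the list [w_1, ..., w_2m]; its action omega v = w_2m ... w_1 v
  applies w_1 first.\<close>
definition word_apply :: "('a::field ^'k^'k) list \<Rightarrow> literal list \<Rightarrow> 'a ^'k \<Rightarrow> 'a ^'k" where
  "word_apply s w v = foldl (\<lambda>x l. lit_mat s l *v x) v w"

text \<open>Number of positions at which letter j (i.e. s_j or its inverse) appears.\<close>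
definition letter_count :: "literal list \<Rightarrow> nat \<Rightarrow> nat" where
  "letter_count w j = count_list (map fst w) j"

definition words :: "nat \<Rightarrow> nat \<Rightarrow> literal list set" where
  "words d len = {w. length w = len \<and> (\<forall>l\<in>set w. fst l < d)}"

definition GL_tuples :: "nat \<Rightarrow> ('a::field ^'k^'k) list set" where
  "GL_tuples d = {s. length s = d \<and> (\<forall>M\<in>set s. invertible M)}"

text \<open>Sample space: word of length 2m and d-tuple of elements of GL_k(F_2), uniform and
  independent (uniform on the product).\<close>
definition sample_space :: "nat \<Rightarrow> nat \<Rightarrow> (literal list \<times> (bit ^'k^'k) list) pmf" where
  "sample_space d m = pmf_of_set (words d (2*m) \<times> GL_tuples d)"

end

theory Submission
  imports Defs
begin

(* Fix all generators except one letter s_j that occurs exactly three times in the word. The word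
  then acts as F3 M^(+-1) F2 M^(+-1) F1 M^(+-1) F0 with M = s_j uniform on GL_k(F_2) and bijections
  F_i fixing 0. Conjugating all generators by a fixed matrix shows that P(w v1 = v1) does not
  depend on the nonzero vector v1, so it suffices to show that the expected number of nonzero fixed
  points of this map is at most 5. Since the fixed points of AB and BA correspond, the word may be
  rotated cyclically; together with replacing M by its inverse this leaves the sign patterns
  M M M and M M M^-1. A fixed point x determines b1 = M x and b2 = M (F1 b1), and the number of M
  realising given (x, b1, b2) is computed from the transitivity of GL_k(F_2) on nonzero vectors,
  on pairs of distinct nonzero vectors and on independent triples: it is |GL|/n, |GL|/(n(n-1))
  or |GL|/(n(n-1)(n-3)). Except for at most 3n exceptional pairs (x, b1), only one value of b2
  leaves the three constraints dependent, and summing up gives at most 5 |GL|. *)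

section \<open>F_2-vectors\<close>

type_synonym 'k bvec = "bit^'k"

type_synonym 'k bmat = "bit^'k^'k"

lemma UNIV_bit: "(UNIV :: bit set) = {0, 1}"
  by (auto intro: bit.exhaust)

instance bit :: finite
  by standard (simp add: UNIV_bit)

lemma card_bit [simp]: "CARD(bit) = 2"
  by (simp add: UNIV_bit)

lemma bvec_uminus [simp]: "- (x :: 'k::finite bvec) = x"
  by (simp add: vec_eq_iff)

lemma bvec_diff: "(x :: 'k::finite bvec) - y = x + y"
  by (metis bvec_uminus diff_conv_add_uminus)

lemma bvec_add_eq_iff: "(x :: 'k::finite bvec) + y = z \<longleftrightarrow> x = y + z"
  by (metis add_diff_cancel_left' bvec_diff)

lemma bvec_add_eq_0_iff: "(x :: 'k::finite bvec) + y = 0 \<longleftrightarrow> x = y"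
  by (metis bvec_add_eq_iff add_0_right)

lemma bvec_add3_eq_0_iff: "(a :: 'k::finite bvec) + b + c = 0 \<longleftrightarrow> b = a + c"
  by (metis add.commute bvec_add_eq_0_iff bvec_add_eq_iff)

lemma ex_bit: "(\<exists>k::bit. P k) \<longleftrightarrow> P 0 \<or> P 1"
  by (metis UNIV_bit UNIV_I insertE singletonD)

lemma span_singleton_bvec: "vec.span {c :: 'k::finite bvec} = {0, c}"
  by (auto simp: vec.span_singleton ex_bit image_def)

lemma span_pair_bvec: "vec.span {b, c :: 'k::finite bvec} = {0, c, b, b + c}"
proof -
  have "x \<in> vec.span {b, c} \<longleftrightarrow> x \<in> {0, c} \<or> x + b \<in> {0, c}" for x
    by (simp add: vec.span_insert[of b] span_singleton_bvec ex_bit bvec_diff)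
  then show ?thesis
    by (auto simp: bvec_add_eq_iff)
qed

section \<open>Counting in finite sets\<close>

lemma card_Compl_finite: "card (- A :: 'a::finite set) = CARD('a) - card A"
  by (simp add: Compl_eq_Diff_UNIV card_Diff_subset)

lemma inj_zero_nonzero: "inj g \<Longrightarrow> g 0 = 0 \<Longrightarrow> b \<noteq> 0 \<Longrightarrow> g b \<noteq> 0"
  by (metis injD)

lemma inj_eq_iff_inv:
  fixes g :: "'a::finite \<Rightarrow> 'a"
  assumes "inj g"
  shows "g y = x \<longleftrightarrow> y = inv g x"
  by (simp add: assms bij_def bij_inv_eq_iff finite_UNIV_inj_surj)

lemma inj_inv_zero:
  fixes g :: "'a::{finite,zero} \<Rightarrow> 'a"
  assumes "inj g" "g 0 = 0"
  shows "inj (inv g)" "inv g 0 = 0"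
  using assms by (metis inj_eq_iff_inv inj_on_inverseI) (metis assms inv_f_f)

lemma card_eq_sum_card_fibers:
  assumes "finite A" "finite B" "f ` A \<subseteq> B"
  shows "card A = (\<Sum>b\<in>B. card {a\<in>A. f a = b})"
  using sum_fun_comp[of A B f "\<lambda>_. 1 :: nat"] assms by simp

lemma sum_card_fibers_le:
  assumes "finite A" "finite B"
  shows "(\<Sum>b\<in>B. card {a\<in>A. f a = b \<and> P a b}) \<le> card A"
proof -
  have "(\<Sum>b\<in>B. card {a\<in>A. f a = b \<and> P a b}) = card (\<Union>b\<in>B. {a\<in>A. f a = b \<and> P a b})"
    by (rule card_UN_disjoint[symmetric]) (use assms in auto)
  also have "\<dots> \<le> card A"
    by (rule card_mono) (use assms in auto)
  finally show ?thesis .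
qed

lemma card_three_graphs_le:
  assumes "finite X"
  shows "card {(x, u) \<in> X \<times> X. u = h1 x \<or> u = h2 x \<or> u = h3 x} \<le> 3 * card X"
proof -
  let ?graph = "\<lambda>h. (\<lambda>x. (x, h x)) ` X"
  have "card {(x, u) \<in> X \<times> X. u = h1 x \<or> u = h2 x \<or> u = h3 x}
      \<le> card (?graph h1 \<union> ?graph h2 \<union> ?graph h3)"
    by (rule card_mono) (use assms in auto)
  also have "\<dots> \<le> card (?graph h1) + card (?graph h2) + card (?graph h3)"
    using card_Un_le[of "?graph h1 \<union> ?graph h2" "?graph h3"] card_Un_le[of "?graph h1" "?graph h2"]
    by linarith
  also have "\<dots> \<le> 3 * card X"
    using card_image_le[OF assms, of "\<lambda>x. (x, h1 x)"] card_image_le[OF assms, of "\<lambda>x. (x, h2 x)"]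
      card_image_le[OF assms, of "\<lambda>x. (x, h3 x)"] by linarith
  finally show ?thesis .
qed

lemma sum_le_one_exception:
  fixes g :: "'a \<Rightarrow> nat"
  assumes "finite X" "card X \<le> n" "n * (n - 1) * g c \<le> N"
    and "\<And>w. w \<in> X - {c} \<Longrightarrow> n * (n - 1) * (n - 3) * g w \<le> N"
  shows "n * (n - 1) * (n - 3) * (\<Sum>w\<in>X. g w) \<le> (n - 3) * N + n * N"
proof -
  define D where "D = n * (n - 1) * (n - 3)"
  have "(\<Sum>w\<in>X. g w) \<le> g c + (\<Sum>w\<in>X - {c}. g w)"
    using assms(1) by (cases "c \<in> X") (simp_all add: sum.remove)
  then have "D * (\<Sum>w\<in>X. g w) \<le> D * g c + (\<Sum>w\<in>X - {c}. D * g w)"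
    by (metis distrib_left mult_le_mono2 sum_distrib_left)
  also have "D * g c = (n - 3) * (n * (n - 1) * g c)"
    by (simp add: D_def ac_simps)
  also have "\<dots> + (\<Sum>w\<in>X - {c}. D * g w) \<le> (n - 3) * N + (\<Sum>w\<in>X - {c}. N)"
    using assms(3,4) unfolding D_def by (intro add_mono mult_left_mono sum_mono) auto
  also have "(\<Sum>w\<in>X - {c}. N) \<le> n * N"
    using assms(1,2) card_Diff1_le[of X c] by simp
  finally show ?thesis
    by (simp add: D_def)
qed

lemma triple_sum_arith:
  fixes n e N :: nat
  assumes "n \<ge> 7" "e \<le> 3 * n"
  shows "e * ((n - 1) * (n - 3) * N) + (n * n - e) * ((n - 3) * N + n * N)
    \<le> n * (n - 1) * (n - 3) * (5 * N)"
proof -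
  define m k where "m = int n" and "k = int e"
  have "m \<ge> 7" "0 \<le> k" "k \<le> 3 * m"
    using assms by (simp_all add: m_def k_def)
  have "k * (m * (m - 6) + 6) \<le> (3 * m) * (m * (m - 6) + 6)"
    using \<open>m \<ge> 7\<close> \<open>k \<le> 3 * m\<close> by (intro mult_right_mono) simp_all
  moreover have "0 \<le> m * (m - 3)"
    using \<open>m \<ge> 7\<close> by simp
  ultimately have "k * ((m - 1) * (m - 3)) + (m * m - k) * ((m - 3) + m)
      \<le> 5 * (m * (m - 1) * (m - 3))"
    by (simp add: algebra_simps)
  then have "(k * ((m - 1) * (m - 3)) + (m * m - k) * ((m - 3) + m)) * int N
      \<le> 5 * (m * (m - 1) * (m - 3)) * int N"
    by (rule mult_right_mono) simp
  then have "k * ((m - 1) * (m - 3) * int N) + (m * m - k) * ((m - 3) * int N + m * int N)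
      \<le> m * (m - 1) * (m - 3) * (5 * int N)"
    by (simp add: algebra_simps)
  moreover have "e \<le> n * n"
  proof -
    have "3 * n \<le> n * n"
      using assms(1) by (intro mult_right_mono) simp_all
    then show ?thesis
      using assms(2) by linarith
  qed
  moreover have "1 \<le> n" "3 \<le> n"
    using assms(1) by simp_all
  ultimately have "int (e * ((n - 1) * (n - 3) * N) + (n * n - e) * ((n - 3) * N + n * N))
      \<le> int (n * (n - 1) * (n - 3) * (5 * N))"
    unfolding m_def k_def by (simp add: of_nat_diff)
  then show ?thesis
    by (simp only: of_nat_le_iff)
qed

lemma sum_le_exceptional:
  fixes F :: "'a \<Rightarrow> nat"
  assumes "finite P" "E \<subseteq> P" "\<And>p. p \<in> E \<Longrightarrow> F p \<le> a" "\<And>p. p \<in> P - E \<Longrightarrow> F p \<le> b"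
  shows "sum F P \<le> card E * a + (card P - card E) * b"
proof -
  have "sum F P = sum F E + sum F (P - E)"
    using assms(1,2) by (simp add: sum.subset_diff)
  also have "\<dots> \<le> (\<Sum>p\<in>E. a) + (\<Sum>p\<in>P - E. b)"
    using assms(3,4) by (intro add_mono sum_mono) auto
  moreover have "finite E"
    using assms(1,2) finite_subset by blast
  ultimately show ?thesis
    using assms(2) by (simp add: card_Diff_subset)
qed

lemma triple_sum_le:
  fixes f :: "'a \<Rightarrow> 'a \<Rightarrow> 'a \<Rightarrow> nat"
  assumes X: "finite X" "card X = n" "n \<ge> 7"
    and row: "\<And>x u. x \<in> X \<Longrightarrow> u \<in> X \<Longrightarrow> n * (\<Sum>w\<in>X. f x u w) \<le> N"
    and E: "E \<subseteq> X \<times> X" "card E \<le> 3 * n"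
    and generic: "\<And>x u. x \<in> X \<Longrightarrow> u \<in> X \<Longrightarrow> (x, u) \<notin> E \<Longrightarrow>
      \<exists>c. n * (n - 1) * f x u c \<le> N \<and> (\<forall>w\<in>X - {c}. n * (n - 1) * (n - 3) * f x u w \<le> N)"
  shows "(\<Sum>x\<in>X. \<Sum>u\<in>X. \<Sum>w\<in>X. f x u w) \<le> 5 * N"
proof -
  define D where "D = n * (n - 1) * (n - 3)"
  define F where "F = (\<lambda>(x, u). D * (\<Sum>w\<in>X. f x u w))"
  have on_E: "F p \<le> (n - 1) * (n - 3) * N" if "p \<in> X \<times> X" for p
  proof -
    have "F p = (n - 1) * (n - 3) * (n * (\<Sum>w\<in>X. f (fst p) (snd p) w))"
      by (simp add: F_def D_def ac_simps split: prod.split)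
    also have "\<dots> \<le> (n - 1) * (n - 3) * N"
      using row that by (intro mult_le_mono2) auto
    finally show ?thesis .
  qed
  have off_E: "F p \<le> (n - 3) * N + n * N" if "p \<in> X \<times> X - E" for p
  proof -
    obtain x u where "p = (x, u)" "x \<in> X" "u \<in> X" "(x, u) \<notin> E"
      using \<open>p \<in> X \<times> X - E\<close> by auto
    moreover obtain c where "n * (n - 1) * f x u c \<le> N"
      "\<forall>w\<in>X - {c}. n * (n - 1) * (n - 3) * f x u w \<le> N"
      using generic calculation by blast
    ultimately show ?thesis
      unfolding D_def F_def using sum_le_one_exception[of X n "f x u" c N] X(1,2) by simp
  qed
  have "D * (\<Sum>x\<in>X. \<Sum>u\<in>X. \<Sum>w\<in>X. f x u w) = sum F (X \<times> X)"
    unfolding F_def sum.cartesian_product[symmetric] by (simp only: sum_distrib_left)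
  also have "\<dots> \<le> card E * ((n - 1) * (n - 3) * N) + (card (X \<times> X) - card E) * ((n - 3) * N + n * N)"
    by (rule sum_le_exceptional) (use on_E off_E E(1) X(1) in auto)
  also have "\<dots> \<le> D * (5 * N)"
    using triple_sum_arith[OF X(3) E(2)] X(1,2) by (simp only: D_def card_cartesian_product)
  finally show ?thesis
    using X(3) by (simp add: D_def)
qed

definition nonzero_fixpoints :: "('a::zero \<Rightarrow> 'a) \<Rightarrow> 'a set" where
  "nonzero_fixpoints f = {x. x \<noteq> 0 \<and> f x = x}"

lemma card_nonzero_fixpoints_comp_commute:
  assumes "f 0 = 0" "g 0 = 0"
  shows "card (nonzero_fixpoints (f \<circ> g)) = card (nonzero_fixpoints (g \<circ> f))"
proof (rule bij_betw_same_card[of g])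
  show "bij_betw g (nonzero_fixpoints (f \<circ> g)) (nonzero_fixpoints (g \<circ> f))"
    by (rule bij_betw_byWitness[where f' = f]) (use assms in \<open>auto simp: nonzero_fixpoints_def\<close>)
qed

lemma sum_card_nonzero_fixpoints_swap:
  fixes f :: "'b \<Rightarrow> 'a::{zero,finite} \<Rightarrow> 'a"
  assumes "finite S"
  shows "(\<Sum>s\<in>S. card (nonzero_fixpoints (f s))) = (\<Sum>x\<in>- {0}. card {s\<in>S. f s x = x})"
proof -
  have "nonzero_fixpoints (f s) = {x\<in>- {0}. f s x = x}" for s
    by (auto simp: nonzero_fixpoints_def)
  then show ?thesis
    by (simp only:) (rule sum_multicount_gen, use assms in auto)
qed

section \<open>Invertible matrices\<close>

definition GL :: "('a::field^'n^'n) set" where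
  "GL = {M. invertible M}"

lemma matrix_inv_left: "invertible (M :: 'a::field^'n^'n) \<Longrightarrow> matrix_inv M ** M = mat 1"
  and matrix_inv_right: "invertible (M :: 'a::field^'n^'n) \<Longrightarrow> M ** matrix_inv M = mat 1"
  unfolding invertible_def matrix_inv_def by (metis (mono_tags, lifting) someI_ex)+

lemma matrix_inv_eqI:
  fixes A B :: "'a::field^'n^'n"
  assumes "A ** B = mat 1" "B ** A = mat 1"
  shows "matrix_inv A = B"
proof -
  have "invertible A"
    using assms invertible_def by blast
  then show ?thesis
    by (metis assms(1) matrix_inv_left matrix_mul_assoc matrix_mul_lid matrix_mul_rid)
qed

lemma invertible_matrix_inv: "invertible (M :: 'a::field^'n^'n) \<Longrightarrow> invertible (matrix_inv M)"
  using matrix_inv_left matrix_inv_right invertible_def by blast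

lemma matrix_inv_matrix_inv: "invertible (M :: 'a::field^'n^'n) \<Longrightarrow> matrix_inv (matrix_inv M) = M"
  by (simp add: matrix_inv_eqI matrix_inv_left matrix_inv_right)

lemma matrix_inv_mult_vector [simp]:
  "invertible (M :: 'a::field^'n^'n) \<Longrightarrow> matrix_inv M *v (M *v x) = x"
  by (simp add: matrix_vector_mul_assoc matrix_inv_left)

lemma mult_matrix_inv_vector [simp]:
  "invertible (M :: 'a::field^'n^'n) \<Longrightarrow> M *v (matrix_inv M *v x) = x"
  by (simp add: matrix_vector_mul_assoc matrix_inv_right)

lemma invertible_mult_vector_eq_iff:
  "invertible (M :: 'a::field^'n^'n) \<Longrightarrow> M *v x = M *v y \<longleftrightarrow> x = y"
  by (metis matrix_inv_mult_vector)

lemma invertible_mult_vector_eq_0_iff: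
  "invertible (M :: 'a::field^'n^'n) \<Longrightarrow> M *v x = 0 \<longleftrightarrow> x = 0"
  by (metis invertible_mult_vector_eq_iff matrix_vector_mult_0_right)

lemma matrix_inv_mult_vector_eq_iff:
  "invertible (M :: 'a::field^'n^'n) \<Longrightarrow> matrix_inv M *v x = y \<longleftrightarrow> M *v y = x"
  by (metis matrix_inv_mult_vector mult_matrix_inv_vector)

lemma invertible_mat_1: "invertible (mat 1 :: 'a::field^'n^'n)"
  unfolding invertible_def by (metis matrix_mul_lid)

lemma ex_invertible_extension:
  fixes f :: "'a::field^'n \<Rightarrow> 'a^'n"
  assumes "vec.independent B" "vec.independent (f ` B)" "inj_on f B"
  shows "\<exists>h. invertible h \<and> (\<forall>x\<in>B. h *v x = f x)"
proof -
  obtain g where g: "Vector_Spaces.linear (*s) (*s) g" "inj g" "\<forall>x\<in>B. g x = f x"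
    using vec.linear_independent_extend_inj[OF assms] by blast
  have "(*v) (matrix g) = g"
    using matrix_works[OF g(1)] by auto
  moreover have "bij g"
    using g vec.linear_inj_imp_surj by (simp add: bij_def)
  ultimately have "invertible (matrix g)"
    by (simp add: invertible_eq_bij)
  then show ?thesis
    using g(3) \<open>(*v) (matrix g) = g\<close> by metis
qed

definition matrix_pm :: "bool \<Rightarrow> 'a::field^'n^'n \<Rightarrow> 'a^'n^'n" where
  "matrix_pm e M = (if e then M else matrix_inv M)"

lemma invertible_matrix_pm: "invertible M \<Longrightarrow> invertible (matrix_pm e M)"
  by (simp add: matrix_pm_def invertible_matrix_inv)

lemma matrix_pm_matrix_inv: "invertible M \<Longrightarrow> matrix_pm e (matrix_inv M) = matrix_pm (\<not> e) M"
  by (simp add: matrix_pm_def matrix_inv_matrix_inv)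

lemma matrix_pm_conj:
  fixes h A :: "'a::field^'n^'n"
  assumes "invertible h" "invertible A"
  shows "matrix_pm e (matrix_inv h ** A ** h) = matrix_inv h ** matrix_pm e A ** h"
proof -
  have "matrix_inv (matrix_inv h ** A ** h) = matrix_inv h ** matrix_inv A ** h"
    using assms by (intro matrix_inv_eqI)
      (simp_all add: matrix_mul_assoc matrix_inv_left matrix_inv_right,
       simp_all add: matrix_mul_assoc[symmetric] matrix_inv_left matrix_inv_right)
  then show ?thesis
    by (simp add: matrix_pm_def)
qed

section \<open>Orbits of GL_k(F_2) on tuples of vectors\<close>

definition independent3 :: "'k::finite bvec \<Rightarrow> 'k bvec \<Rightarrow> 'k bvec \<Rightarrow> bool" where
  "independent3 a b c \<longleftrightarrow> a \<noteq> 0 \<and> b \<noteq> 0 \<and> c \<noteq> 0 \<and> a \<noteq> b \<and> a \<noteq> c \<and> b \<noteq> c \<and> a + b + c \<noteq> 0"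

lemma independent_pair_bvec:
  "b \<noteq> 0 \<Longrightarrow> c \<noteq> 0 \<Longrightarrow> b \<noteq> c \<Longrightarrow> vec.independent {b, c :: 'k::finite bvec}"
  by (simp add: vec.independent_insert span_singleton_bvec)

lemma independent3_imp_independent: "independent3 a b c \<Longrightarrow> vec.independent {a, b, c}"
proof -
  assume abc: "independent3 a b c"
  have "a + b + c = 0 \<longleftrightarrow> a = b + c"
    using bvec_add_eq_0_iff[of "a + b" c] bvec_add_eq_iff[of a b c] by simp
  then have "a \<notin> vec.span {b, c}"
    using abc by (auto simp: independent3_def span_pair_bvec)
  moreover have "vec.independent {b, c}"
    using abc by (simp add: independent3_def independent_pair_bvec)
  ultimately show ?thesis
    using abc by (simp add: vec.independent_insert independent3_def)
qed

lemma independent3_mult_vector: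
  fixes M :: "'k::finite bmat"
  assumes "invertible M"
  shows "independent3 (M *v a) (M *v b) (M *v c) \<longleftrightarrow> independent3 a b c"
proof -
  have "M *v a + M *v b + M *v c = M *v (a + b + c)"
    by (simp add: matrix_vector_right_distrib)
  then show ?thesis
    using invertible_mult_vector_eq_iff[OF assms] invertible_mult_vector_eq_0_iff[OF assms]
    by (simp add: independent3_def)
qed

lemma ex_invertible_map1:
  fixes a a' :: "'k::finite bvec"
  assumes "a \<noteq> 0" "a' \<noteq> 0"
  shows "\<exists>h\<in>GL. h *v a = a'"
  using ex_invertible_extension[of "{a}" "\<lambda>_. a'"] assms by (auto simp: GL_def)

lemma ex_invertible_map2:
  fixes a b a' b' :: "'k::finite bvec"
  assumes "a \<noteq> 0" "b \<noteq> 0" "a \<noteq> b" "a' \<noteq> 0" "b' \<noteq> 0" "a' \<noteq> b'"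
  shows "\<exists>h\<in>GL. h *v a = a' \<and> h *v b = b'"
proof -
  let ?f = "\<lambda>x. if x = a then a' else b'"
  have "vec.independent {a, b}" "vec.independent {a', b'}"
    using assms by (simp_all add: independent_pair_bvec)
  moreover have "?f ` {a, b} = {a', b'}" "inj_on ?f {a, b}"
    using assms by (auto simp: inj_on_def)
  ultimately show ?thesis
    using ex_invertible_extension[of "{a, b}" ?f] assms by (auto simp: GL_def)
qed

lemma ex_invertible_map3:
  fixes a b c a' b' c' :: "'k::finite bvec"
  assumes "independent3 a b c" "independent3 a' b' c'"
  shows "\<exists>h\<in>GL. h *v a = a' \<and> h *v b = b' \<and> h *v c = c'"
proof -
  let ?f = "\<lambda>x. if x = a then a' else if x = b then b' else c'"
  have distinct: "a \<noteq> b" "a \<noteq> c" "b \<noteq> c" "a' \<noteq> b'" "a' \<noteq> c'" "b' \<noteq> c'"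
    using assms unfolding independent3_def by blast+
  have image: "?f ` {a, b, c} = {a', b', c'}"
    using distinct by auto
  have "inj_on ?f {a, b, c}"
    using distinct unfolding inj_on_def by simp
  then obtain h where "invertible h" "\<forall>x\<in>{a, b, c}. h *v x = ?f x"
    using ex_invertible_extension[of "{a, b, c}" ?f] independent3_imp_independent assms
    unfolding image by blast
  then show ?thesis
    using distinct by (auto simp: GL_def)
qed

lemma card_orbit_mult_card_fiber_le:
  fixes \<phi> :: "('a::{field,finite})^'n^'n \<Rightarrow> 'b"
  assumes "finite T" and into: "\<And>M. M \<in> GL \<Longrightarrow> \<phi> M \<in> T"
    and transitive: "\<And>t t'. t \<in> T \<Longrightarrow> t' \<in> T \<Longrightarrow> \<exists>h\<in>GL. \<forall>M\<in>GL. \<phi> M = t \<longrightarrow> \<phi> (h ** M) = t'"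
  shows "card T * card {M\<in>GL. \<phi> M = q} \<le> card (GL :: ('a^'n^'n) set)"
proof (cases "q \<in> T")
  case False
  then have "{M\<in>GL. \<phi> M = q} = {}"
    using into by blast
  then show ?thesis
    by (metis card.empty le0 mult_0_right)
next
  case True
  have fiber_le: "card {M\<in>GL. \<phi> M = q} \<le> card {M\<in>GL. \<phi> M = t}" if "t \<in> T" for t
  proof -
    obtain h where h: "h \<in> GL" "\<forall>M\<in>GL. \<phi> M = q \<longrightarrow> \<phi> (h ** M) = t"
      using transitive[OF True \<open>t \<in> T\<close>] by blast
    have "inj ((**) h)"
      using h(1)
      by (metis GL_def injI matrix_inv_left matrix_mul_assoc matrix_mul_lid mem_Collect_eq)
    moreover have "(**) h ` {M\<in>GL. \<phi> M = q} \<subseteq> {M\<in>GL. \<phi> M = t}"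
      using h by (auto simp: GL_def invertible_mult)
    ultimately show ?thesis
      by (meson card_inj_on_le finite inj_on_subset subset_UNIV)
  qed
  have "card T * card {M\<in>GL. \<phi> M = q} \<le> (\<Sum>t\<in>T. card {M\<in>GL. \<phi> M = t})"
    using sum_mono[OF fiber_le] by simp
  also have "\<dots> = card (\<Union>t\<in>T. {M\<in>GL. \<phi> M = t})"
    by (rule card_UN_disjoint[symmetric]) (use \<open>finite T\<close> in auto)
  also have "(\<Union>t\<in>T. {M\<in>GL. \<phi> M = t}) = GL"
    using into by blast
  finally show ?thesis .
qed

lemma card_GL_map1_le:
  fixes p q :: "'k::finite bvec"
  assumes "p \<noteq> 0"
  shows "(CARD('k bvec) - 1) * card {M\<in>GL. M *v p = q} \<le> card (GL :: 'k bmat set)"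
proof -
  have "card (- {0 :: 'k bvec}) * card {M\<in>GL. M *v p = q} \<le> card (GL :: 'k bmat set)"
  proof (rule card_orbit_mult_card_fiber_le)
    show "M *v p \<in> - {0}" if "M \<in> GL" for M
      using that assms by (simp add: GL_def invertible_mult_vector_eq_0_iff)
    fix t t' :: "'k bvec"
    assume "t \<in> - {0}" "t' \<in> - {0}"
    then obtain h where "h \<in> GL" "h *v t = t'"
      using ex_invertible_map1 by blast
    then show "\<exists>h\<in>GL. \<forall>M\<in>GL. M *v p = t \<longrightarrow> (h ** M) *v p = t'"
      by (auto simp: matrix_vector_mul_assoc[symmetric])
  qed simp
  then show ?thesis
    by (simp add: card_Compl_finite)
qed

lemma card_distinct_nonzero_pairs:
  "card {(a, b). a \<noteq> 0 \<and> b \<noteq> 0 \<and> a \<noteq> (b :: 'k::finite bvec)}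
    = (CARD('k bvec) - 1) * (CARD('k bvec) - 2)"
proof -
  have "{(a, b). a \<noteq> 0 \<and> b \<noteq> 0 \<and> a \<noteq> b} = Sigma (- {0 :: 'k bvec}) (\<lambda>a. - {0, a})"
    by auto
  then show ?thesis
    by (simp add: card_Compl_finite numeral_2_eq_2)
qed

lemma card_independent3:
  "card {((a, b), c). independent3 a b (c :: 'k::finite bvec)}
    = (CARD('k bvec) - 1) * (CARD('k bvec) - 2) * (CARD('k bvec) - 4)"
proof -
  let ?P = "{(a, b). a \<noteq> 0 \<and> b \<noteq> 0 \<and> a \<noteq> (b :: 'k bvec)}"
  let ?C = "\<lambda>(a, b). - {0, a, b, a + b}"
  have "independent3 a b c \<longleftrightarrow> a \<noteq> 0 \<and> b \<noteq> 0 \<and> a \<noteq> b \<and> c \<notin> {0, a, b, a + b}" for a b c :: "'k bvec"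
    using bvec_add_eq_0_iff[of "a + b" c] bvec_add_eq_0_iff[of a b] by (auto simp: independent3_def)
  then have "{((a, b), c). independent3 a b c} = Sigma ?P ?C"
    by auto
  moreover have "card (?C p) = CARD('k bvec) - 4" if "p \<in> ?P" for p
  proof -
    obtain a b where "p = (a, b)" "a \<noteq> 0" "b \<noteq> 0" "a \<noteq> b"
      using \<open>p \<in> ?P\<close> by auto
    moreover have "a + b \<noteq> 0"
      using \<open>a \<noteq> b\<close> by (simp add: bvec_add_eq_0_iff)
    ultimately show ?thesis
      using card_Compl_finite[of "{0, a, b, a + b}"] by auto
  qed
  then have "card (Sigma ?P ?C) = card ?P * (CARD('k bvec) - 4)"
    by (simp del: card_SigmaI add: card_SigmaI[of ?P ?C] sum.cong[of ?P ?P "\<lambda>p. card (?C p)"])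
  ultimately show ?thesis
    by (simp only: card_distinct_nonzero_pairs)
qed

lemma card_GL_map2_le:
  fixes p1 p2 q1 q2 :: "'k::finite bvec"
  assumes "p1 \<noteq> 0" "p2 \<noteq> 0" "p1 \<noteq> p2"
  shows "(CARD('k bvec) - 1) * (CARD('k bvec) - 2) * card {M\<in>GL. M *v p1 = q1 \<and> M *v p2 = q2}
    \<le> card (GL :: 'k bmat set)"
proof -
  let ?T = "{(a, b). a \<noteq> 0 \<and> b \<noteq> 0 \<and> a \<noteq> (b :: 'k bvec)}"
  have "card ?T * card {M\<in>GL. (M *v p1, M *v p2) = (q1, q2)} \<le> card (GL :: 'k bmat set)"
  proof (rule card_orbit_mult_card_fiber_le)
    show "(M *v p1, M *v p2) \<in> ?T" if "M \<in> GL" for M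
      using that assms
      by (simp add: GL_def invertible_mult_vector_eq_0_iff invertible_mult_vector_eq_iff)
    fix t t' :: "'k bvec \<times> 'k bvec"
    assume "t \<in> ?T" "t' \<in> ?T"
    then obtain a b a' b' where "t = (a, b)" "t' = (a', b')"
      and "a \<noteq> 0" "b \<noteq> 0" "a \<noteq> b" "a' \<noteq> 0" "b' \<noteq> 0" "a' \<noteq> b'"
      by auto
    moreover obtain h where "h \<in> GL" "h *v a = a'" "h *v b = b'"
      using ex_invertible_map2 calculation by metis
    ultimately show "\<exists>h\<in>GL. \<forall>M\<in>GL. (M *v p1, M *v p2) = t \<longrightarrow> ((h ** M) *v p1, (h ** M) *v p2) = t'"
      by (auto simp: matrix_vector_mul_assoc[symmetric])
  qed simp
  then show ?thesis
    by (simp add: card_distinct_nonzero_pairs)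
qed

lemma card_GL_map3_le:
  fixes p1 p2 p3 q1 q2 q3 :: "'k::finite bvec"
  assumes indep: "\<And>M. M \<in> GL \<Longrightarrow> M *v p1 = q1 \<Longrightarrow> M *v p2 = q2 \<Longrightarrow> M *v p3 = q3 \<Longrightarrow>
    independent3 p1 p2 p3"
  shows "(CARD('k bvec) - 1) * (CARD('k bvec) - 2) * (CARD('k bvec) - 4)
      * card {M\<in>GL. M *v p1 = q1 \<and> M *v p2 = q2 \<and> M *v p3 = q3}
    \<le> card (GL :: 'k bmat set)"
proof (cases "independent3 p1 p2 p3")
  case False
  then have "{M\<in>GL. M *v p1 = q1 \<and> M *v p2 = q2 \<and> M *v p3 = q3} = {}"
    using indep by blast
  then show ?thesis
    by (metis card.empty le0 mult_0_right)
next
  case True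
  let ?T = "{((a, b), c). independent3 a b (c :: 'k bvec)}"
  have "card ?T * card {M\<in>GL. ((M *v p1, M *v p2), M *v p3) = ((q1, q2), q3)}
      \<le> card (GL :: 'k bmat set)"
  proof (rule card_orbit_mult_card_fiber_le)
    show "((M *v p1, M *v p2), M *v p3) \<in> ?T" if "M \<in> GL" for M
      using that True by (simp add: GL_def independent3_mult_vector)
    fix t t' :: "('k bvec \<times> 'k bvec) \<times> 'k bvec"
    assume "t \<in> ?T" "t' \<in> ?T"
    then obtain a b c a' b' c' where t: "t = ((a, b), c)" "t' = ((a', b'), c')"
      and "independent3 a b c" "independent3 a' b' c'"
      by auto
    then obtain h where "h \<in> GL" "h *v a = a'" "h *v b = b'" "h *v c = c'"
      using ex_invertible_map3 by metis
    with t show "\<exists>h\<in>GL. \<forall>M\<in>GL. ((M *v p1, M *v p2), M *v p3) = t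
        \<longrightarrow> (((h ** M) *v p1, (h ** M) *v p2), (h ** M) *v p3) = t'"
      by (auto simp: matrix_vector_mul_assoc[symmetric])
  qed simp
  then show ?thesis
    by (simp add: card_independent3)
qed

section \<open>A word with three occurrences of one matrix\<close>

definition word3 :: "bool \<Rightarrow> bool \<Rightarrow> bool \<Rightarrow> ('a^'n \<Rightarrow> 'a^'n) \<Rightarrow> ('a^'n \<Rightarrow> 'a^'n) \<Rightarrow>
    ('a^'n \<Rightarrow> 'a^'n) \<Rightarrow> 'a::field^'n^'n \<Rightarrow> 'a^'n \<Rightarrow> 'a^'n" where
  "word3 e1 e2 e3 g1 g2 g3 M =
    g3 \<circ> (*v) (matrix_pm e3 M) \<circ> g2 \<circ> (*v) (matrix_pm e2 M) \<circ> g1 \<circ> (*v) (matrix_pm e1 M)"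

lemma card_fixpoints_word3_rotate:
  assumes "g1 0 = 0" "g2 0 = 0" "g3 0 = 0"
  shows "card (nonzero_fixpoints (word3 e1 e2 e3 g1 g2 g3 M))
    = card (nonzero_fixpoints (word3 e2 e3 e1 g2 g3 g1 M))"
  using card_nonzero_fixpoints_comp_commute[of
      "g3 \<circ> (*v) (matrix_pm e3 M) \<circ> g2 \<circ> (*v) (matrix_pm e2 M)" "g1 \<circ> (*v) (matrix_pm e1 M)"] assms
  by (simp add: word3_def comp_assoc)

lemma sum_fixpoints_word3_inverse:
  fixes g1 g2 g3 :: "'a::field^'n \<Rightarrow> 'a^'n"
  shows "(\<Sum>M\<in>GL. card (nonzero_fixpoints (word3 e1 e2 e3 g1 g2 g3 M)))
    = (\<Sum>M\<in>GL. card (nonzero_fixpoints (word3 (\<not> e1) (\<not> e2) (\<not> e3) g1 g2 g3 M)))"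
proof -
  have inverse: "word3 (\<not> e1) (\<not> e2) (\<not> e3) g1 g2 g3 (matrix_inv M) = word3 e1 e2 e3 g1 g2 g3 M"
    if "M \<in> GL" for M :: "'a^'n^'n"
    using that by (simp add: word3_def matrix_pm_matrix_inv invertible_matrix_inv GL_def)
  have "bij_betw matrix_inv GL (GL :: ('a^'n^'n) set)"
    by (rule bij_betw_byWitness[where f' = matrix_inv])
      (auto simp: GL_def matrix_inv_matrix_inv invertible_matrix_inv)
  have "(\<Sum>M\<in>GL. card (nonzero_fixpoints (word3 e1 e2 e3 g1 g2 g3 M)))
      = (\<Sum>M\<in>GL. card (nonzero_fixpoints (word3 (\<not> e1) (\<not> e2) (\<not> e3) g1 g2 g3 (matrix_inv M))))"
    by (rule sum.cong) (simp_all only: inverse)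
  also have "\<dots> = (\<Sum>M\<in>GL. card (nonzero_fixpoints (word3 (\<not> e1) (\<not> e2) (\<not> e3) g1 g2 g3 M)))"
    by (rule sum.reindex_bij_betw) fact
  finally show ?thesis .
qed

lemma sum_fixpoints_word3_TT_eq:
  fixes g1 g2 g3 :: "'k::finite bvec \<Rightarrow> 'k bvec"
  assumes g1: "\<And>b. b \<noteq> 0 \<Longrightarrow> g1 b \<noteq> 0"
  shows "(\<Sum>M\<in>GL. card (nonzero_fixpoints (word3 True True e3 g1 g2 g3 M)))
    = (\<Sum>x\<in>- {0}. \<Sum>b1\<in>- {0}. \<Sum>b2\<in>- {0}.
        card {M\<in>GL. M *v x = b1 \<and> M *v g1 b1 = b2 \<and> g3 (matrix_pm e3 M *v g2 b2) = x})"
proof -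
  have "(\<Sum>M\<in>GL. card (nonzero_fixpoints (word3 True True e3 g1 g2 g3 M)))
      = (\<Sum>x\<in>- {0}. card {M\<in>GL. word3 True True e3 g1 g2 g3 M x = x})"
    by (rule sum_card_nonzero_fixpoints_swap) simp
  also have "\<dots> = (\<Sum>x\<in>- {0}. \<Sum>b1\<in>- {0}. \<Sum>b2\<in>- {0}.
      card {M\<in>GL. M *v x = b1 \<and> M *v g1 b1 = b2 \<and> g3 (matrix_pm e3 M *v g2 b2) = x})"
  proof (rule sum.cong[OF refl])
    fix x :: "'k bvec"
    assume "x \<in> - {0}"
    let ?A = "{M\<in>GL. word3 True True e3 g1 g2 g3 M x = x}"
    have nonzero: "M *v y \<noteq> 0" if "M \<in> GL" "y \<noteq> 0" for M :: "'k bmat" and y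
      using that by (simp add: GL_def invertible_mult_vector_eq_0_iff)
    have "(\<lambda>M. (M *v x, M *v g1 (M *v x))) ` ?A \<subseteq> (- {0}) \<times> (- {0})"
      using \<open>x \<in> - {0}\<close> by (auto simp: nonzero g1)
    then have "card ?A = (\<Sum>b\<in>(- {0}) \<times> (- {0}). card {M\<in>?A. (M *v x, M *v g1 (M *v x)) = b})"
      by (intro card_eq_sum_card_fibers) simp_all
    also have "\<dots> = (\<Sum>b1\<in>- {0}. \<Sum>b2\<in>- {0}. card {M\<in>?A. (M *v x, M *v g1 (M *v x)) = (b1, b2)})"
      by (rule sum.cartesian_product')
    also have "\<dots> = (\<Sum>b1\<in>- {0}. \<Sum>b2\<in>- {0}.
        card {M\<in>GL. M *v x = b1 \<and> M *v g1 b1 = b2 \<and> g3 (matrix_pm e3 M *v g2 b2) = x})"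
      by (intro sum.cong refl arg_cong[where f = card]) (auto simp: word3_def matrix_pm_def)
    finally show "card ?A = \<dots>" .
  qed
  finally show ?thesis .
qed

lemma card_GL_row_le:
  fixes x b1 :: "'k::finite bvec"
  assumes "x \<noteq> 0"
  shows "(CARD('k bvec) - 1) * (\<Sum>b2\<in>- {0}. card {M\<in>GL. M *v x = b1 \<and> M *v g b1 = b2 \<and> P M b2})
    \<le> card (GL :: 'k bmat set)"
proof -
  have "(\<Sum>b2\<in>- {0}. card {M\<in>GL. M *v x = b1 \<and> M *v g b1 = b2 \<and> P M b2})
      = (\<Sum>b2\<in>- {0}. card {M\<in>{M\<in>GL. M *v x = b1}. M *v g b1 = b2 \<and> P M b2})"
    by (simp add: conj_assoc)
  also have "\<dots> \<le> card {M\<in>GL. M *v x = b1}"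
    by (rule sum_card_fibers_le) simp_all
  finally show ?thesis
    using card_GL_map1_le[OF assms, of b1] by (meson le_trans mult_le_mono2)
qed

lemma sum_card_GL_TT_le:
  fixes g ha hb hc :: "'k::finite bvec \<Rightarrow> 'k bvec" and R :: "'k bmat \<Rightarrow> 'k bvec \<Rightarrow> 'k bvec \<Rightarrow> bool"
  defines "S x b1 b2 \<equiv> {M\<in>GL. M *v x = b1 \<and> M *v g b1 = b2 \<and> R M x b2}"
  assumes "CARD('k bvec) \<ge> 8"
    and generic: "\<And>x b1. x \<noteq> 0 \<Longrightarrow> b1 \<noteq> 0 \<Longrightarrow> b1 \<noteq> ha x \<Longrightarrow> b1 \<noteq> hb x \<Longrightarrow> b1 \<noteq> hc x \<Longrightarrow>
      \<exists>c. (CARD('k bvec) - 1) * (CARD('k bvec) - 2) * card (S x b1 c) \<le> card (GL :: 'k bmat set)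
        \<and> (\<forall>w\<in>- {0} - {c}. (CARD('k bvec) - 1) * (CARD('k bvec) - 2) * (CARD('k bvec) - 4)
              * card (S x b1 w) \<le> card (GL :: 'k bmat set))"
  shows "(\<Sum>x\<in>- {0}. \<Sum>b1\<in>- {0}. \<Sum>b2\<in>- {0}. card (S x b1 b2)) \<le> 5 * card (GL :: 'k bmat set)"
proof (rule triple_sum_le)
  let ?E = "{(x, b1) \<in> (- {0}) \<times> (- {0}). b1 = ha x \<or> b1 = hb x \<or> b1 = hc x}"
  show "finite (- {0 :: 'k bvec})" "card (- {0 :: 'k bvec}) = CARD('k bvec) - 1"
    "CARD('k bvec) - 1 \<ge> 7"
    using assms(2) by (simp_all add: card_Compl_finite)
  show "(CARD('k bvec) - 1) * (\<Sum>b2\<in>- {0}. card (S x b1 b2)) \<le> card (GL :: 'k bmat set)"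
    if "x \<in> - {0}" for x b1
    unfolding S_def using that by (intro card_GL_row_le) simp
  show "?E \<subseteq> (- {0}) \<times> (- {0})"
    by auto
  show "card ?E \<le> 3 * (CARD('k bvec) - 1)"
    using card_three_graphs_le[of "- {0}" ha hb hc] by (simp add: card_Compl_finite)
  show "\<exists>c. (CARD('k bvec) - 1) * (CARD('k bvec) - 1 - 1) * card (S x b1 c)
      \<le> card (GL :: 'k bmat set)
      \<and> (\<forall>w\<in>- {0} - {c}. (CARD('k bvec) - 1) * (CARD('k bvec) - 1 - 1) * (CARD('k bvec) - 1 - 3)
          * card (S x b1 w) \<le> card (GL :: 'k bmat set))"
    if "x \<in> - {0}" "b1 \<in> - {0}" "(x, b1) \<notin> ?E" for x b1
    using generic[of x b1] that by (simp add: numeral_2_eq_2)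
qed

(* The targets b1, w, gz x of the three constraints are independent unless w = b1 + gz x. *)
lemma card_GL_word3_TTT_generic:
  fixes g1 g2 gz :: "'k::finite bvec \<Rightarrow> 'k bvec" and x b1 :: "'k bvec"
  assumes nonzero: "\<And>b. b \<noteq> 0 \<Longrightarrow> g1 b \<noteq> 0" "\<And>b. b \<noteq> 0 \<Longrightarrow> gz b \<noteq> 0"
    and "x \<noteq> 0" "b1 \<noteq> 0"
    and generic: "g1 b1 \<noteq> x" "b1 \<noteq> gz x" "g1 b1 \<noteq> g2 (gz x)"
  defines "S w \<equiv> {M\<in>GL. M *v x = b1 \<and> M *v g1 b1 = w \<and> M *v g2 w = gz x}"
  shows "(CARD('k bvec) - 1) * (CARD('k bvec) - 2) * card (S (b1 + gz x))
      \<le> card (GL :: 'k bmat set)"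
    and "w \<noteq> 0 \<Longrightarrow> w \<noteq> b1 + gz x \<Longrightarrow>
      (CARD('k bvec) - 1) * (CARD('k bvec) - 2) * (CARD('k bvec) - 4) * card (S w)
          \<le> card (GL :: 'k bmat set)"
proof -
  have "card (S (b1 + gz x)) \<le> card {M\<in>GL. M *v x = b1 \<and> M *v g1 b1 = b1 + gz x}"
    unfolding S_def by (rule card_mono) auto
  moreover have "(CARD('k bvec) - 1) * (CARD('k bvec) - 2)
      * card {M\<in>GL. M *v x = b1 \<and> M *v g1 b1 = b1 + gz x} \<le> card (GL :: 'k bmat set)"
    using nonzero(1) assms(3,4) generic(1) by (intro card_GL_map2_le) auto
  ultimately show "(CARD('k bvec) - 1) * (CARD('k bvec) - 2) * card (S (b1 + gz x))
      \<le> card (GL :: 'k bmat set)"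
    by (meson le_trans mult_le_mono2)
next
  assume "w \<noteq> 0" "w \<noteq> b1 + gz x"
  show "(CARD('k bvec) - 1) * (CARD('k bvec) - 2) * (CARD('k bvec) - 4) * card (S w)
      \<le> card (GL :: 'k bmat set)"
    unfolding S_def
  proof (rule card_GL_map3_le)
    fix M :: "'k bmat"
    assume M: "M \<in> GL" "M *v x = b1" "M *v g1 b1 = w" "M *v g2 w = gz x"
    then have inv: "invertible M"
      by (simp add: GL_def)
    have "b1 \<noteq> w"
      using M(2,3) generic(1) invertible_mult_vector_eq_iff[OF inv] by metis
    moreover have "w \<noteq> gz x"
      using M(3,4) generic(3) invertible_mult_vector_eq_iff[OF inv] by metis
    ultimately have "independent3 b1 w (gz x)"
      using generic(2) nonzero(2) \<open>x \<noteq> 0\<close> \<open>b1 \<noteq> 0\<close> \<open>w \<noteq> 0\<close> \<open>w \<noteq> b1 + gz x\<close>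
      by (simp add: independent3_def bvec_add3_eq_0_iff)
    then show "independent3 x (g1 b1) (g2 w)"
      using M(2-4) independent3_mult_vector[OF inv, of x "g1 b1" "g2 w"] by simp
  qed
qed

lemma sum_fixpoints_word3_TTT_le:
  fixes g1 g2 g3 :: "'k::finite bvec \<Rightarrow> 'k bvec"
  assumes "inj g1" "g1 0 = 0" "inj g3" "g3 0 = 0" "CARD('k bvec) \<ge> 8"
  shows "(\<Sum>M\<in>GL. card (nonzero_fixpoints (word3 True True True g1 g2 g3 M)))
      \<le> 5 * card (GL :: 'k bmat set)"
proof -
  define gz where "gz = inv g3"
  have nonzero: "\<And>b. b \<noteq> 0 \<Longrightarrow> g1 b \<noteq> 0" "\<And>b. b \<noteq> 0 \<Longrightarrow> gz b \<noteq> 0"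
    using inj_zero_nonzero inj_inv_zero assms(1-4) unfolding gz_def by blast+
  have "(\<Sum>M\<in>GL. card (nonzero_fixpoints (word3 True True True g1 g2 g3 M)))
      = (\<Sum>x\<in>- {0}. \<Sum>b1\<in>- {0}. \<Sum>b2\<in>- {0}.
          card {M\<in>GL. M *v x = b1 \<and> M *v g1 b1 = b2 \<and> g3 (matrix_pm True M *v g2 b2) = x})"
    by (rule sum_fixpoints_word3_TT_eq) (rule nonzero(1))
  also have "\<dots> = (\<Sum>x\<in>- {0}. \<Sum>b1\<in>- {0}. \<Sum>b2\<in>- {0}.
      card {M\<in>GL. M *v x = b1 \<and> M *v g1 b1 = b2 \<and> M *v g2 b2 = gz x})"
    by (simp add: matrix_pm_def gz_def inj_eq_iff_inv[OF assms(3)])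
  also have "\<dots> \<le> 5 * card (GL :: 'k bmat set)"
  proof (rule sum_card_GL_TT_le[where ha = "inv g1" and hb = gz and hc = "\<lambda>x. inv g1 (g2 (gz x))"])
    show "CARD('k bvec) \<ge> 8"
      by fact
    fix x b1 :: "'k bvec"
    assume "x \<noteq> 0" "b1 \<noteq> 0" "b1 \<noteq> inv g1 x" "b1 \<noteq> gz x" "b1 \<noteq> inv g1 (g2 (gz x))"
    moreover have "g1 b1 \<noteq> x" "g1 b1 \<noteq> g2 (gz x)"
      using calculation inj_eq_iff_inv[OF assms(1)] by blast+
    ultimately show "\<exists>c. (CARD('k bvec) - 1) * (CARD('k bvec) - 2)
          * card {M\<in>GL. M *v x = b1 \<and> M *v g1 b1 = c \<and> M *v g2 c = gz x} \<le> card (GL :: 'k bmat set)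
        \<and> (\<forall>w\<in>- {0} - {c}. (CARD('k bvec) - 1) * (CARD('k bvec) - 2) * (CARD('k bvec) - 4)
          * card {M\<in>GL. M *v x = b1 \<and> M *v g1 b1 = w \<and> M *v g2 w = gz x}
              \<le> card (GL :: 'k bmat set))"
      using card_GL_word3_TTT_generic[of g1 gz x b1 g2, OF nonzero]
      by (intro exI[of _ "b1 + gz x"]) auto
  qed
  finally show ?thesis .
qed

(* Only for w = inv g2 b1 can the constraints M x = b1 and M (gz x) = g2 w hold with x = gz x. *)
lemma card_GL_word3_TTF_generic:
  fixes g1 g2 gz :: "'k::finite bvec \<Rightarrow> 'k bvec" and x b1 :: "'k bvec"
  assumes nonzero: "\<And>b. b \<noteq> 0 \<Longrightarrow> g1 b \<noteq> 0" "\<And>b. b \<noteq> 0 \<Longrightarrow> gz b \<noteq> 0" and "inj g2"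
    and "x \<noteq> 0" "b1 \<noteq> 0"
    and generic: "g1 b1 \<noteq> x" "g1 b1 \<noteq> gz x" "g1 b1 \<noteq> x + gz x"
  defines "S w \<equiv> {M\<in>GL. M *v x = b1 \<and> M *v g1 b1 = w \<and> M *v gz x = g2 w}"
  shows "(CARD('k bvec) - 1) * (CARD('k bvec) - 2) * card (S (inv g2 b1))
      \<le> card (GL :: 'k bmat set)"
    and "w \<noteq> inv g2 b1 \<Longrightarrow>
      (CARD('k bvec) - 1) * (CARD('k bvec) - 2) * (CARD('k bvec) - 4) * card (S w)
          \<le> card (GL :: 'k bmat set)"
proof -
  have "card (S (inv g2 b1)) \<le> card {M\<in>GL. M *v x = b1 \<and> M *v g1 b1 = inv g2 b1}"
    unfolding S_def by (rule card_mono) auto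
  moreover have "(CARD('k bvec) - 1) * (CARD('k bvec) - 2)
      * card {M\<in>GL. M *v x = b1 \<and> M *v g1 b1 = inv g2 b1} \<le> card (GL :: 'k bmat set)"
    using nonzero(1) assms(4,5) generic(1) by (intro card_GL_map2_le) auto
  ultimately show "(CARD('k bvec) - 1) * (CARD('k bvec) - 2) * card (S (inv g2 b1))
      \<le> card (GL :: 'k bmat set)"
    by (meson le_trans mult_le_mono2)
next
  assume "w \<noteq> inv g2 b1"
  show "(CARD('k bvec) - 1) * (CARD('k bvec) - 2) * (CARD('k bvec) - 4) * card (S w)
      \<le> card (GL :: 'k bmat set)"
    unfolding S_def
  proof (rule card_GL_map3_le)
    fix M :: "'k bmat"
    assume M: "M \<in> GL" "M *v x = b1" "M *v g1 b1 = w" "M *v gz x = g2 w"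
    have "x \<noteq> gz x"
    proof
      assume "x = gz x"
      then have "g2 w = b1"
        using M(2,4) by simp
      then show False
        using \<open>w \<noteq> inv g2 b1\<close> inj_eq_iff_inv[OF \<open>inj g2\<close>] by blast
    qed
    then show "independent3 x (g1 b1) (gz x)"
      using generic nonzero \<open>x \<noteq> 0\<close> \<open>b1 \<noteq> 0\<close>
      by (auto simp: independent3_def bvec_add3_eq_0_iff)
  qed
qed

lemma sum_fixpoints_word3_TTF_le:
  fixes g1 g2 g3 :: "'k::finite bvec \<Rightarrow> 'k bvec"
  assumes "inj g1" "g1 0 = 0" "inj g2" "inj g3" "g3 0 = 0" "CARD('k bvec) \<ge> 8"
  shows "(\<Sum>M\<in>GL. card (nonzero_fixpoints (word3 True True False g1 g2 g3 M)))
      \<le> 5 * card (GL :: 'k bmat set)"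
proof -
  define gz where "gz = inv g3"
  have nonzero: "\<And>b. b \<noteq> 0 \<Longrightarrow> g1 b \<noteq> 0" "\<And>b. b \<noteq> 0 \<Longrightarrow> gz b \<noteq> 0"
    using inj_zero_nonzero inj_inv_zero assms(1,2,4,5) unfolding gz_def by blast+
  have "(\<Sum>M\<in>GL. card (nonzero_fixpoints (word3 True True False g1 g2 g3 M)))
      = (\<Sum>x\<in>- {0}. \<Sum>b1\<in>- {0}. \<Sum>b2\<in>- {0}.
          card {M\<in>GL. M *v x = b1 \<and> M *v g1 b1 = b2 \<and> g3 (matrix_pm False M *v g2 b2) = x})"
    by (rule sum_fixpoints_word3_TT_eq) (rule nonzero(1))
  also have "\<dots> = (\<Sum>x\<in>- {0}. \<Sum>b1\<in>- {0}. \<Sum>b2\<in>- {0}.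
      card {M\<in>GL. M *v x = b1 \<and> M *v g1 b1 = b2 \<and> M *v gz x = g2 b2})"
    by (intro sum.cong refl arg_cong[where f = card] Collect_cong)
      (auto simp: matrix_pm_def gz_def GL_def inj_eq_iff_inv[OF assms(4)]
        matrix_inv_mult_vector_eq_iff)
  also have "\<dots> \<le> 5 * card (GL :: 'k bmat set)"
  proof (rule sum_card_GL_TT_le[where ha = "inv g1" and hb = "\<lambda>x. inv g1 (gz x)"
        and hc = "\<lambda>x. inv g1 (x + gz x)"])
    show "CARD('k bvec) \<ge> 8"
      by fact
    fix x b1 :: "'k bvec"
    assume "x \<noteq> 0" "b1 \<noteq> 0" "b1 \<noteq> inv g1 x" "b1 \<noteq> inv g1 (gz x)" "b1 \<noteq> inv g1 (x + gz x)"
    moreover have "g1 b1 \<noteq> x" "g1 b1 \<noteq> gz x" "g1 b1 \<noteq> x + gz x"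
      using calculation inj_eq_iff_inv[OF assms(1)] by blast+
    ultimately show "\<exists>c. (CARD('k bvec) - 1) * (CARD('k bvec) - 2)
          * card {M\<in>GL. M *v x = b1 \<and> M *v g1 b1 = c \<and> M *v gz x = g2 c} \<le> card (GL :: 'k bmat set)
        \<and> (\<forall>w\<in>- {0} - {c}. (CARD('k bvec) - 1) * (CARD('k bvec) - 2) * (CARD('k bvec) - 4)
          * card {M\<in>GL. M *v x = b1 \<and> M *v g1 b1 = w \<and> M *v gz x = g2 w}
              \<le> card (GL :: 'k bmat set))"
      using card_GL_word3_TTF_generic[of g1 gz g2 x b1, OF nonzero assms(3)]
      by (intro exI[of _ "inv g2 b1"]) auto
  qed
  finally show ?thesis .
qed

lemma sum_fixpoints_word3_small:
  fixes g1 g2 g3 :: "'k::finite bvec \<Rightarrow> 'k bvec"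
  assumes "CARD('k bvec) < 8"
  shows "(\<Sum>M\<in>GL. card (nonzero_fixpoints (word3 e1 e2 e3 g1 g2 g3 M)))
      \<le> 5 * card (GL :: 'k bmat set)"
proof -
  have "even (CARD('k bvec))"
    by simp
  then have "CARD('k bvec) \<le> 6"
    using assms by presburger
  then have "card (nonzero_fixpoints (word3 e1 e2 e3 g1 g2 g3 M)) \<le> 5" for M :: "'k bmat"
    using card_mono[of "- {0}" "nonzero_fixpoints (word3 e1 e2 e3 g1 g2 g3 M)"]
    by (force simp: nonzero_fixpoints_def card_Compl_finite)
  then show ?thesis
    using sum_bounded_above[of GL "\<lambda>M. card (nonzero_fixpoints (word3 e1 e2 e3 g1 g2 g3 M))" 5]
    by simp
qed

lemma sum_fixpoints_word3_equal_signs_le: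
  fixes g1 g2 g3 :: "'k::finite bvec \<Rightarrow> 'k bvec"
  assumes "inj g1" "inj g2" "inj g3" "g1 0 = 0" "g3 0 = 0" "CARD('k bvec) \<ge> 8"
  shows "(\<Sum>M\<in>GL. card (nonzero_fixpoints (word3 e e e' g1 g2 g3 M))) \<le> 5 * card (GL :: 'k bmat set)"
proof -
  have TT: "(\<Sum>M\<in>GL. card (nonzero_fixpoints (word3 True True e'' g1 g2 g3 M)))
      \<le> 5 * card (GL :: 'k bmat set)"
    for e''
    using sum_fixpoints_word3_TTT_le[OF assms(1,4,3,5,6)]
      sum_fixpoints_word3_TTF_le[OF assms(1,4,2,3,5,6)]
    by (cases e'') simp_all
  show ?thesis
  proof (cases e)
    case True
    then show ?thesis
      using TT by simp
  next
    case False
    then show ?thesis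
      using TT[of "\<not> e'"] sum_fixpoints_word3_inverse[of False False e' g1 g2 g3]
      by (simp only: not_False_eq_True)
  qed
qed

(* Among three signs two cyclically adjacent ones agree; rotate them to the front. *)
lemma sum_fixpoints_word3_le:
  fixes g1 g2 g3 :: "'k::finite bvec \<Rightarrow> 'k bvec"
  assumes g: "inj g1" "inj g2" "inj g3" "g1 0 = 0" "g2 0 = 0" "g3 0 = 0"
  shows "(\<Sum>M\<in>GL. card (nonzero_fixpoints (word3 e1 e2 e3 g1 g2 g3 M)))
      \<le> 5 * card (GL :: 'k bmat set)"
proof (cases "CARD('k bvec) \<ge> 8")
  case False
  then show ?thesis
    by (simp add: sum_fixpoints_word3_small)
next
  case True
  let ?total = "\<lambda>e1 e2 e3 g1 g2 g3.
    \<Sum>M\<in>GL. card (nonzero_fixpoints (word3 e1 e2 e3 g1 g2 g3 (M :: 'k bmat)))"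
  have rotate: "?total e1 e2 e3 g1 g2 g3 = ?total e2 e3 e1 g2 g3 g1"
    if "g1 0 = 0" "g2 0 = 0" "g3 0 = 0" for e1 e2 e3 and g1 g2 g3 :: "'k bvec \<Rightarrow> 'k bvec"
    using card_fixpoints_word3_rotate[of g1 g2 g3, OF that] by simp
  consider "e1 = e2" | "e2 = e3" | "e3 = e1"
    by blast
  then show ?thesis
  proof cases
    case 1
    then show ?thesis
      using sum_fixpoints_word3_equal_signs_le[OF g(1-4,6) True] by simp
  next
    case 2
    then show ?thesis
      using sum_fixpoints_word3_equal_signs_le[OF g(2,3,1,5,4) True, of e2 e1]
        rotate[of g1 g2 g3 e1 e2 e3] g
      by simp
  next
    case 3
    then show ?thesis
      using sum_fixpoints_word3_equal_signs_le[OF g(3,1,2,6,5) True, of e3 e2]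
        rotate[of g1 g2 g3 e1 e2 e3] rotate[of g2 g3 g1 e2 e3 e1] g
      by simp
  qed
qed

section \<open>Random words in random generators\<close>

lemma lit_mat_eq: "lit_mat s l = matrix_pm (snd l) (s ! fst l)"
  by (simp add: lit_mat_def matrix_pm_def)

lemma word_apply_Nil [simp]: "word_apply s [] = id"
  by (simp add: word_apply_def fun_eq_iff)

lemma word_apply_Cons [simp]: "word_apply s (l # w) = word_apply s w \<circ> (*v) (lit_mat s l)"
  by (simp add: word_apply_def fun_eq_iff)

lemma word_apply_append [simp]: "word_apply s (u @ v) = word_apply s v \<circ> word_apply s u"
  by (simp add: word_apply_def fun_eq_iff)

lemma finite_GL_tuples [simp]: "finite (GL_tuples d :: ('a::{field,finite}^'n^'n) list set)"
proof (rule finite_subset)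
  show "GL_tuples d \<subseteq> {s :: ('a^'n^'n) list. length s = d}"
    by (auto simp: GL_tuples_def)
  show "finite {s :: ('a^'n^'n) list. length s = d}"
    using finite_lists_length_eq[of "UNIV :: ('a^'n^'n) set" d] by simp
qed

lemma finite_words [simp]: "finite (words d len)"
proof (rule finite_subset)
  show "words d len \<subseteq> {w. set w \<subseteq> {..<d} \<times> UNIV \<and> length w = len}"
    by (auto simp: words_def)
  show "finite {w. set w \<subseteq> {..<d} \<times> (UNIV :: bool set) \<and> length w = len}"
    by (simp add: finite_lists_length_eq)
qed

lemma invertible_lit_mat:
  "s \<in> GL_tuples d \<Longrightarrow> fst l < d \<Longrightarrow> invertible (lit_mat s l)"
  by (auto simp: GL_tuples_def lit_mat_eq invertible_matrix_pm)

lemma word_apply_zero: "word_apply s w (0 :: 'a::field^'n) = 0"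
  by (induction w) simp_all

lemma inj_word_apply:
  assumes "s \<in> GL_tuples d" "\<forall>l\<in>set w. fst l < d"
  shows "inj (word_apply (s :: ('a::field^'n^'n) list) w)"
  using assms(2)
proof (induction w)
  case (Cons l w)
  then have "inj ((*v) (lit_mat s l))"
    by (intro inj_matrix_vector_mult invertible_lit_mat[OF assms(1)]) simp
  then show ?case
    unfolding word_apply_Cons using Cons by (intro inj_compose) simp_all
qed simp

lemma word_apply_update_notin:
  "j \<notin> fst ` set w \<Longrightarrow> word_apply (s[j := M]) w = word_apply s w"
  by (induction w) (auto simp: lit_mat_def)

definition conj_tuple :: "'a::field^'n^'n \<Rightarrow> ('a^'n^'n) list \<Rightarrow> ('a^'n^'n) list" where
  "conj_tuple h s = map (\<lambda>A. matrix_inv h ** A ** h) s"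

lemma word_apply_conj_tuple:
  fixes s :: "('a::field^'n^'n) list"
  assumes "s \<in> GL_tuples d" "\<forall>l\<in>set w. fst l < d" "invertible h"
  shows "word_apply (conj_tuple h s) w = (*v) (matrix_inv h) \<circ> word_apply s w \<circ> (*v) h"
  using assms(2)
proof (induction w)
  case Nil
  then show ?case
    using assms(3) by (simp add: fun_eq_iff)
next
  case (Cons l w)
  have "invertible (s ! fst l)"
    using assms(1) Cons.prems by (auto simp: GL_tuples_def)
  then have "lit_mat (conj_tuple h s) l = matrix_inv h ** lit_mat s l ** h"
    using assms(1,3) Cons.prems
    by (auto simp: GL_tuples_def conj_tuple_def lit_mat_eq matrix_pm_conj)
  then show ?case
    using Cons assms(3)
    by (simp add: fun_eq_iff matrix_vector_mul_assoc[symmetric] matrix_mul_assoc matrix_inv_right)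
qed

lemma card_fixing_tuples_le:
  fixes a b :: "'k::finite bvec"
  assumes "w \<in> words d len" "a \<noteq> 0" "b \<noteq> 0"
  shows "card {s\<in>GL_tuples d. word_apply s w a = a} \<le> card {s\<in>GL_tuples d. word_apply s w b = b}"
proof -
  obtain h where "h \<in> GL" "h *v b = a"
    using ex_invertible_map1 assms(2,3) by metis
  then have h: "invertible h" "h *v b = a"
    by (simp_all add: GL_def)
  have letters: "\<forall>l\<in>set w. fst l < d"
    using assms(1) by (simp add: words_def)
  have "inj (conj_tuple h)"
    unfolding conj_tuple_def
    by (intro inj_mapI injI)
      (metis h(1) matrix_inv_right matrix_mul_assoc matrix_mul_lid matrix_mul_rid)
  moreover have "conj_tuple h s \<in> {s\<in>GL_tuples d. word_apply s w b = b}"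
    if "s \<in> {s\<in>GL_tuples d. word_apply s w a = a}" for s
  proof -
    have "conj_tuple h s \<in> GL_tuples d"
      using that h(1)
      by (auto simp: GL_tuples_def conj_tuple_def invertible_mult invertible_matrix_inv)
    moreover have "word_apply (conj_tuple h s) w b = b"
      using that h word_apply_conj_tuple[OF _ letters h(1)] matrix_inv_mult_vector[OF h(1), of b]
      by simp
    ultimately show ?thesis
      by simp
  qed
  ultimately show ?thesis
    by (intro card_inj_on_le[where f = "conj_tuple h"]) (auto intro: inj_on_subset)
qed

lemma sum_GL_tuples_update:
  fixes f :: "('a::field^'n^'n) list \<Rightarrow> nat"
  assumes "j < d"
  shows "(\<Sum>s\<in>GL_tuples d. f s) = (\<Sum>r\<in>{r\<in>GL_tuples d. r ! j = mat 1}. \<Sum>M\<in>GL. f (r[j := M]))"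
proof -
  let ?R = "{r\<in>GL_tuples d. r ! j = mat 1}"
  have "bij_betw (\<lambda>(r, M). r[j := M]) (?R \<times> GL) (GL_tuples d)"
  proof (rule bij_betw_byWitness[where f' = "\<lambda>s. (s[j := mat 1], s ! j)"])
    show "\<forall>p\<in>?R \<times> GL. (\<lambda>s. (s[j := mat 1], s ! j)) ((\<lambda>(r, M). r[j := M]) p) = p"
      using assms by (auto simp: GL_tuples_def) (metis list_update_id)
    show "\<forall>s\<in>GL_tuples d. (\<lambda>(r, M). r[j := M]) (s[j := mat 1], s ! j) = s"
      by simp
    show "(\<lambda>(r, M). r[j := M]) ` (?R \<times> GL) \<subseteq> GL_tuples d"
      using set_update_subset_insert by (fastforce simp: GL_tuples_def GL_def)
    show "(\<lambda>s. (s[j := mat 1], s ! j)) ` GL_tuples d \<subseteq> ?R \<times> GL"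
      using assms set_update_subset_insert invertible_mat_1
      by (fastforce simp: GL_tuples_def GL_def)
  qed
  then have "(\<Sum>p\<in>?R \<times> GL. f ((\<lambda>(r, M). r[j := M]) p)) = (\<Sum>s\<in>GL_tuples d. f s)"
    by (rule sum.reindex_bij_betw)
  then show ?thesis
    by (simp add: sum.cartesian_product split_def)
qed

lemma split_first_letter:
  assumes "letter_count w j = Suc c"
  obtains w0 l w' where "w = w0 @ l # w'" "fst l = j" "j \<notin> fst ` set w0" "letter_count w' j = c"
proof -
  obtain pref rest where "map fst w = pref @ j # rest" "j \<notin> set pref" "count_list rest j = c"
    using count_list_Suc_split_first assms unfolding letter_count_def by metis
  then obtain w0 l w' where "w = w0 @ l # w'" "map fst w0 = pref" "fst l = j" "map fst w' = rest"
    by (auto simp: map_eq_append_conv)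
  then show ?thesis
    using \<open>j \<notin> set pref\<close> \<open>count_list rest j = c\<close>
    by (intro that[of w0 l w']) (auto simp: letter_count_def simp flip: set_map)
qed

lemma split_three_occurrences:
  assumes "letter_count w j = 3"
  obtains w0 l1 w1 l2 w2 l3 w3 where "w = w0 @ l1 # w1 @ l2 # w2 @ l3 # w3"
    and "fst l1 = j" "fst l2 = j" "fst l3 = j"
    and "j \<notin> fst ` set w0" "j \<notin> fst ` set w1" "j \<notin> fst ` set w2" "j \<notin> fst ` set w3"
proof -
  obtain w0 l1 u1 w1 l2 u2 w2 l3 w3 where "w = w0 @ l1 # u1" "u1 = w1 @ l2 # u2" "u2 = w2 @ l3 # w3"
    "fst l1 = j" "fst l2 = j" "fst l3 = j" "j \<notin> fst ` set w0" "j \<notin> fst ` set w1" "j \<notin> fst ` set w2"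
    "letter_count w3 j = 0"
    using assms split_first_letter[of w j 2] split_first_letter[of _ j 1]
      split_first_letter[of _ j 0]
    by (metis numeral_2_eq_2 numeral_3_eq_3 One_nat_def)
  then show ?thesis
    using that by (simp add: letter_count_def count_list_0_iff image_iff)
qed

lemma sum_fixpoints_update_le:
  fixes r :: "'k::finite bmat list"
  assumes r: "r \<in> GL_tuples d" and letters: "\<forall>l\<in>set w. fst l < d" and three: "letter_count w j = 3"
  shows "(\<Sum>M\<in>GL. card (nonzero_fixpoints (word_apply (r[j := M]) w)))
      \<le> 5 * card (GL :: 'k bmat set)"
proof -
  obtain w0 l1 w1 l2 w2 l3 w3 where w: "w = w0 @ l1 # w1 @ l2 # w2 @ l3 # w3"
    and l: "fst l1 = j" "fst l2 = j" "fst l3 = j"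
    and notin: "j \<notin> fst ` set w0" "j \<notin> fst ` set w1" "j \<notin> fst ` set w2" "j \<notin> fst ` set w3"
    using split_three_occurrences[OF three] .
  have "j < length r"
    using r letters l(1) by (auto simp: GL_tuples_def w)
  define F0 F1 F2 F3 where "F0 = word_apply r w0" and "F1 = word_apply r w1"
    and "F2 = word_apply r w2" and "F3 = word_apply r w3"
  let ?act = "\<lambda>l (M :: 'k bmat). (*v) (matrix_pm (snd l) M)"
  have word: "word_apply (r[j := M]) w
      = (F3 \<circ> ?act l3 M \<circ> F2 \<circ> ?act l2 M \<circ> F1 \<circ> ?act l1 M) \<circ> F0" for M
    using \<open>j < length r\<close> l notin
    by (simp add: w F0_def F1_def F2_def F3_def word_apply_update_notin lit_mat_eq comp_assoc)
  have subwords: "\<forall>l\<in>set u. fst l < d" if "u \<in> {w0, w1, w2, w3}" for u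
    using letters that by (auto simp: w)
  have "inj F0" "inj F1" "inj F2" "inj F3"
    unfolding F0_def F1_def F2_def F3_def using inj_word_apply[OF r] subwords by blast+
  moreover have "F0 0 = 0" "F1 0 = 0" "F2 0 = 0" "F3 0 = 0"
    by (simp_all add: F0_def F1_def F2_def F3_def word_apply_zero)
  ultimately have "(\<Sum>M\<in>GL.
        card (nonzero_fixpoints (word3 (snd l1) (snd l2) (snd l3) F1 F2 (F0 \<circ> F3) M)))
      \<le> 5 * card (GL :: 'k bmat set)"
    by (intro sum_fixpoints_word3_le) (simp_all add: inj_compose)
  moreover have "card (nonzero_fixpoints (word_apply (r[j := M]) w))
      = card (nonzero_fixpoints (word3 (snd l1) (snd l2) (snd l3) F1 F2 (F0 \<circ> F3) M))" for M
    unfolding word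
    using card_nonzero_fixpoints_comp_commute[of
        "F3 \<circ> ?act l3 M \<circ> F2 \<circ> ?act l2 M \<circ> F1 \<circ> ?act l1 M" F0]
      \<open>F0 0 = 0\<close> \<open>F1 0 = 0\<close> \<open>F2 0 = 0\<close> \<open>F3 0 = 0\<close>
    by (simp add: word3_def comp_assoc)
  ultimately show ?thesis
    by simp
qed

lemma card_fixing_tuples_le_five:
  fixes v :: "'k::finite bvec"
  assumes w: "w \<in> words d len" and three: "letter_count w j = 3" and "v \<noteq> 0"
  shows "(CARD('k bvec) - 1) * card {s\<in>GL_tuples d. word_apply s w v = v}
    \<le> 5 * card (GL_tuples d :: 'k bmat list set)"
proof -
  let ?R = "{r\<in>GL_tuples d. r ! j = mat 1} :: 'k bmat list set"
  have letters: "\<forall>l\<in>set w. fst l < d"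
    using w by (simp add: words_def)
  moreover have "j \<in> fst ` set w"
    using three by (metis count_list_0_iff letter_count_def list.set_map zero_neq_numeral)
  ultimately have "j < d"
    by blast
  have same: "card {s\<in>GL_tuples d. word_apply s w x = x}
      = card {s\<in>GL_tuples d. word_apply s w v = v}"
    if "x \<in> - {0}" for x :: "'k bvec"
    using card_fixing_tuples_le[OF w _ \<open>v \<noteq> 0\<close>, of x] card_fixing_tuples_le[OF w \<open>v \<noteq> 0\<close>, of x] that
    by simp
  have "(CARD('k bvec) - 1) * card {s\<in>GL_tuples d. word_apply s w v = v}
      = (\<Sum>x\<in>- {0 :: 'k bvec}. card {s\<in>GL_tuples d. word_apply s w v = v})"
    by (simp add: card_Compl_finite)
  also have "\<dots> = (\<Sum>x\<in>- {0 :: 'k bvec}. card {s\<in>GL_tuples d. word_apply s w x = x})"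
    by (rule sum.cong[OF refl]) (simp add: same)
  also have "\<dots> = (\<Sum>s :: 'k bmat list\<in>GL_tuples d. card (nonzero_fixpoints (word_apply s w)))"
    by (rule sum_card_nonzero_fixpoints_swap[symmetric]) simp
  also have "\<dots> = (\<Sum>r\<in>?R. \<Sum>M\<in>GL. card (nonzero_fixpoints (word_apply (r[j := M]) w)))"
    by (rule sum_GL_tuples_update[OF \<open>j < d\<close>])
  also have "\<dots> \<le> (\<Sum>r\<in>?R. 5 * card (GL :: 'k bmat set))"
    using letters three by (intro sum_mono sum_fixpoints_update_le) auto
  also have "\<dots> = 5 * card (GL_tuples d :: 'k bmat list set)"
    using sum_GL_tuples_update[OF \<open>j < d\<close>, of "\<lambda>_ :: 'k bmat list. 1"] by simp
  finally show ?thesis .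
qed

(* The hypothesis d \<ge> 1 makes the sample space nonempty; pmf_of_set {} is unspecified. *)
lemma cond_prob_sample_space:
  fixes P :: "literal list \<Rightarrow> 'k::finite bmat list \<Rightarrow> bool" and Q :: "literal list \<Rightarrow> bool"
    and d m :: nat
  assumes "d \<ge> 1"
  defines "W \<equiv> {w\<in>words d (2 * m). Q w}"
  shows "cond_prob (measure_pmf (sample_space d m)) (\<lambda>(w, s). P w s) (\<lambda>(w, s). Q w)
    = real (\<Sum>w\<in>W. card {s\<in>GL_tuples d. P w s})
      / real (card W * card (GL_tuples d :: 'k bmat list set))"
proof -
  let ?\<Omega> = "words d (2 * m) \<times> (GL_tuples d :: 'k bmat list set)"
  have "replicate (2 * m) (0, True) \<in> words d (2 * m)" "replicate d (mat 1) \<in> GL_tuples d"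
    using assms(1) invertible_mat_1 by (auto simp: words_def GL_tuples_def)
  then have "?\<Omega> \<noteq> {}"
    by blast
  moreover have "?\<Omega> \<inter> {(w, s). P w s \<and> Q w} = Sigma W (\<lambda>w. {s\<in>GL_tuples d. P w s})"
    "?\<Omega> \<inter> {(w, s). Q w} = W \<times> GL_tuples d"
    by (auto simp: W_def)
  moreover have "finite W"
    by (simp add: W_def)
  ultimately show ?thesis
    unfolding cond_prob_def sample_space_def
    by (simp add: measure_pmf_of_set case_prod_beta' card_SigmaI card_cartesian_product)
qed

lemma cond_prob_fixed_le:
  fixes v :: "'k::finite bvec" and Q :: "literal list \<Rightarrow> bool" and d m :: nat
  assumes "d \<ge> 1" "v \<noteq> 0" and three: "\<And>w. w \<in> words d (2 * m) \<Longrightarrow> Q w \<Longrightarrow> \<exists>j. letter_count w j = 3"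
  shows "cond_prob (measure_pmf (sample_space d m :: (literal list \<times> 'k bmat list) pmf))
      (\<lambda>(w, s). word_apply s w v = v) (\<lambda>(w, s). Q w) \<le> 5 / real (2 ^ CARD('k) - 1)"
proof -
  define W where "W = {w\<in>words d (2 * m). Q w}"
  define n where "n = CARD('k bvec) - 1"
  define a where "a = (\<Sum>w\<in>W. card {s\<in>GL_tuples d. word_apply s w v = v})"
  define b where "b = card W * card (GL_tuples d :: 'k bmat list set)"
  have "n * a = (\<Sum>w\<in>W. n * card {s\<in>GL_tuples d. word_apply s w v = v})"
    by (simp add: a_def sum_distrib_left)
  also have "\<dots> \<le> (\<Sum>w\<in>W. 5 * card (GL_tuples d :: 'k bmat list set))"
  proof (rule sum_mono)
    fix w
    assume "w \<in> W"
    then obtain j where "w \<in> words d (2 * m)" "letter_count w j = 3"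
      using three by (auto simp: W_def)
    then show "n * card {s\<in>GL_tuples d. word_apply s w v = v}
        \<le> 5 * card (GL_tuples d :: 'k bmat list set)"
      unfolding n_def using \<open>v \<noteq> 0\<close> by (rule card_fixing_tuples_le_five)
  qed
  finally have "real n * real a \<le> 5 * real b"
    by (simp add: b_def flip: of_nat_mult)
  moreover have "n > 0"
    using power_increasing[of 1 "CARD('k)" "2 :: nat"] by (simp add: n_def)
  ultimately have "real a / real b \<le> 5 / real n"
    by (cases "b = 0") (simp_all add: field_simps)
  then show ?thesis
    using cond_prob_sample_space[OF \<open>d \<ge> 1\<close>,
        where P = "\<lambda>w s. word_apply s w v = v" and Q = Q and m = m]
    by (simp add: W_def a_def b_def n_def)
qed

theorem lemma4:
  fixes d m :: nat and v1 :: "bit ^'k"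
  assumes "d \<ge> 1" and "v1 \<noteq> 0"
  defines "n \<equiv> 2 ^ CARD('k) - 1"
  shows "cond_prob (measure_pmf (sample_space d m :: (literal list \<times> (bit ^'k^'k) list) pmf))
           (\<lambda>(w, s). word_apply s w v1 = v1)
           (\<lambda>(w, s). \<exists>j<d. letter_count w j = 3) \<le> 5 / real n
       \<and> cond_prob (measure_pmf (sample_space d m :: (literal list \<times> (bit ^'k^'k) list) pmf))
           (\<lambda>(w, s). word_apply s w v1 = v1)
           (\<lambda>(w, s). (\<forall>j<d. letter_count w j \<noteq> 1 \<and> letter_count w j \<noteq> 2)
                     \<and> (\<exists>j<d. letter_count w j = 3)) \<le> 5 / real n"
  unfolding n_def using assms(1,2) by (intro conjI cond_prob_fixed_le) auto

end
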